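(* Let $k\ge 2$ and $r\ge 2$ be integers. The mode(s) of the negative binomial distribution of order $k$, type I, with parameters $r$ and $p=1/2$ are given by $$m_k(r,1/2)=kr+(r-1)\left(2^{k+1}-k-2\right)-1+\delta_{k,r},$$ where $\delta_{k,r}=0$ if $(k,r)\ne(2,2)$ (so that the mode is unique in this case), and $\delta_{k,r}$ takes each of the values $0,+1,-1$ if $k=r=2$ (so that in this case there are exactly three modes, one for each of these values).
   Context: For positive integers $k,r$ and $0<p<1$, $q=1-p$, an integer-valued random variable $X$ has the negative binomial distribution of order $k$, type I, with parameters $r$ and $p$, if its probability mass function is $$P_n=P(X=n)=p^n\sum \binom{n_1+n_2+\cdots+n_k+r-1}{n_1,\,n_2,\ldots,n_k,\,r-1}\left(\frac{q}{p}\right)^{n_1+n_2+\cdots+n_k}\quad (n\ge kr),$$ and $P_n=0$ for $n<kr$, where the sum is over all $k$-tuples of non-negative integers $(n_1,\ldots,n_k)$ with $n_1+2n_2+\cdots+kn_k=n-kr$, and $\binom{N}{a_1,\ldots,a_{k+1}}=\frac{N!}{a_1!\cdots a_{k+1}!}$ denotes the multinomial coefficient. The mode(s) $m_k(r,p)$ of this distribution are the integers $n$ at which $P_n$ attains its maximum. *)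

theory Defs
  imports Complex_Main "HOL-Library.FuncSet"
begin

(* A k-tuple (n_1, ..., n_k) of non-negative integers is an extensional function on {1..k},
   so that distinct functions are distinct tuples. *)
definition weighted_tuples :: "nat \<Rightarrow> int \<Rightarrow> (nat \<Rightarrow> nat) set" where
  "weighted_tuples k m =
     {v \<in> {1..k} \<rightarrow>\<^sub>E (UNIV :: nat set). int (\<Sum>i=1..k. i * v i) = m}"

(* The index set is finite, so the sum in the mass function below is a genuine one. *)
lemma finite_weighted_tuples: "finite (weighted_tuples k m)"
proof (rule finite_subset)
  show "weighted_tuples k m \<subseteq> {1..k} \<rightarrow>\<^sub>E {..nat m}"
  proof
    fix v assume v: "v \<in> weighted_tuples k m"
    have "v j \<le> nat m" if j: "j \<in> {1..k}" for j
    proof -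
      have "v j \<le> j * v j" using j by simp
      also have "\<dots> \<le> (\<Sum>i=1..k. i * v i)"
        using j by (intro member_le_sum) auto
      also have "\<dots> = nat m"
        using v by (auto simp: weighted_tuples_def simp del: of_nat_sum)
      finally show ?thesis .
    qed
    then show "v \<in> {1..k} \<rightarrow>\<^sub>E {..nat m}"
      using v by (auto simp: weighted_tuples_def PiE_iff)
  qed
  show "finite ({1..k} \<rightarrow>\<^sub>E {..nat m})"
    by (intro finite_PiE) auto
qed

(* Probability mass function of the negative binomial distribution of order k, type I, with
   parameters r and p (for k, r \<ge> 1 and 0 < p < 1). The quotient of factorials is the
   multinomial coefficient with lower entries n_1, ..., n_k, r - 1, whose upper entry is their
   sum. *)
definition nb_order_pmf :: "nat \<Rightarrow> nat \<Rightarrow> real \<Rightarrow> int \<Rightarrow> real" where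
  "nb_order_pmf k r p n =
     (if n < int (k * r) then 0
      else p ^ nat n *
        (\<Sum>v \<in> weighted_tuples k (n - int (k * r)).
           fact ((\<Sum>i=1..k. v i) + (r - 1)) / ((\<Prod>i=1..k. fact (v i)) * fact (r - 1))
           * ((1 - p) / p) ^ (\<Sum>i=1..k. v i)))"

definition nb_order_modes :: "nat \<Rightarrow> nat \<Rightarrow> real \<Rightarrow> int set" where
  "nb_order_modes k r p = {n. \<forall>n'. nb_order_pmf k r p n' \<le> nb_order_pmf k r p n}"

(* The set of values taken by the multivalued correction term delta_{k,r}. *)
definition mode_shifts :: "nat \<Rightarrow> nat \<Rightarrow> int set" where
  "mode_shifts k r = (if (k, r) = (2, 2) then {0, 1, -1} else {0})"

end

(* For p = 1/2 the mass at kr + m is, up to a constant factor, b_m = 2^(-m) a_m, where a_m are the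
   coefficients of (1 - x - ... - x^k)^(-r).  Logarithmic differentiation gives
     m b_m = sum_{i=1..k} (m + i(r-1)) 2^(-i) b_{m-i},
   whose weights add up to m + 2^(-k) (N - m) with N = (r-1)(2^(k+1) - k - 2).  Summing by parts and
   eliminating b_m between the relations at m and m - 1 leaves a recurrence
     2 (N - m + 1) m d_m = sum_{j<k} C_j d_{m-1-j}
   for the differences d_m = b_m - b_{m-1} alone.  For 1 <= m < N all C_j are nonnegative, so b
   increases up to N - 1; from N on the weights add up to at most m, so b never exceeds
   b_{N-1} again. *)
theory Submission
  imports Defs
begin

section \<open>Coefficients of (1 - x - ... - x^k)^(-r) as sums over tuples\<close>

definition tuple_weight :: "nat \<Rightarrow> nat \<Rightarrow> (nat \<Rightarrow> nat) \<Rightarrow> real" where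
  "tuple_weight k r v =
     fact ((\<Sum>i=1..k. v i) + (r - 1)) / ((\<Prod>i=1..k. fact (v i)) * fact (r - 1))"

definition tuple_sum :: "nat \<Rightarrow> nat \<Rightarrow> int \<Rightarrow> real" where
  "tuple_sum k r m = (\<Sum>v\<in>weighted_tuples k m. tuple_weight k r v)"

text \<open>For r >= 1 this is r times the coefficient of x^m in (1 - x - ... - x^k)^(-(r+1)),
  because the factor s + r, with s the sum of the v i, raises the factorial (s + r - 1)! to (s +
  r)!.\<close>

definition tuple_sum1 :: "nat \<Rightarrow> nat \<Rightarrow> int \<Rightarrow> real" where
  "tuple_sum1 k r m =
     (\<Sum>v\<in>weighted_tuples k m. (real (\<Sum>i=1..k. v i) + real r) * tuple_weight k r v)"

lemma weighted_tuples_neg: "m < 0 \<Longrightarrow> weighted_tuples k m = {}"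
  by (auto simp: weighted_tuples_def simp del: of_nat_sum)

lemma weighted_tuples_zero: "weighted_tuples k 0 = {\<lambda>i\<in>{1..k}. 0}"
proof (intro equalityI subsetI)
  fix v assume v: "v \<in> weighted_tuples k 0"
  then have "(\<Sum>i=1..k. i * v i) = 0"
    by (simp add: weighted_tuples_def del: of_nat_sum)
  then have "\<And>i. i \<in> {1..k} \<Longrightarrow> v i = 0"
    by (subst (asm) sum_eq_0_iff) auto
  moreover have "v \<in> extensional {1..k}"
    using v by (simp add: weighted_tuples_def PiE_def)
  ultimately show "v \<in> {\<lambda>i\<in>{1..k}. 0}"
    by (auto intro!: extensionalityI[of _ "{1..k}"])
qed (simp add: weighted_tuples_def)

lemma tuple_sum_neg: "m < 0 \<Longrightarrow> tuple_sum k r m = 0"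
  by (simp add: tuple_sum_def weighted_tuples_neg)

lemma tuple_sum_zero: "tuple_sum k r 0 = 1"
  by (simp add: tuple_sum_def weighted_tuples_zero tuple_weight_def)

lemma
  fixes v :: "nat \<Rightarrow> nat"
  assumes i: "i \<in> {1..k}"
  shows sum_increment: "(\<Sum>l=1..k. (v(i := Suc (v i))) l) = Suc (\<Sum>l=1..k. v l)"
    and weighted_sum_increment:
      "(\<Sum>l=1..k. l * (v(i := Suc (v i))) l) = (\<Sum>l=1..k. l * v l) + i"
    and prod_fact_increment:
      "(\<Prod>l=1..k. fact ((v(i := Suc (v i))) l)) = (real (Suc (v i)) * (\<Prod>l=1..k. fact (v l)))"
proof -
  note * = sum.remove[OF finite_atLeastAtMost i] prod.remove[OF finite_atLeastAtMost i]
  show "(\<Sum>l=1..k. (v(i := Suc (v i))) l) = Suc (\<Sum>l=1..k. v l)"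
    unfolding * by (simp cong: sum.cong_simp)
  show "(\<Sum>l=1..k. l * (v(i := Suc (v i))) l) = (\<Sum>l=1..k. l * v l) + i"
    unfolding * by (simp cong: sum.cong_simp)
  show "(\<Prod>l=1..k. fact ((v(i := Suc (v i))) l)) = (real (Suc (v i)) * (\<Prod>l=1..k. fact (v l)))"
    unfolding * by (simp cong: prod.cong_simp add: algebra_simps)
qed

lemma tuple_weight_increment:
  assumes i: "i \<in> {1..k}" and r: "r \<ge> 1"
  shows "real (Suc (v i)) * tuple_weight k r (v(i := Suc (v i))) =
    (real (\<Sum>l=1..k. v l) + real r) * tuple_weight k r v"
proof -
  have "fact (Suc s + (r - 1)) = (real s + real r) * fact (s + (r - 1))" for s
    using r by (cases r) simp_all
  from this[of "\<Sum>l=1..k. v l"] show ?thesis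
    unfolding tuple_weight_def sum_increment[OF i] prod_fact_increment[OF i]
    by (simp only: divide_simps) (simp del: of_nat_Suc of_nat_sum)
qed

lemma increment_in_weighted_tuples:
  assumes i: "i \<in> {1..k}"
  shows "v(i := Suc (v i)) \<in> weighted_tuples k m \<longleftrightarrow>
    v \<in> weighted_tuples k (m - int i)"
proof -
  have "v(i := Suc (v i)) \<in> {1..k} \<rightarrow>\<^sub>E UNIV \<longleftrightarrow> v \<in> {1..k} \<rightarrow>\<^sub>E UNIV"
    using i by (auto simp: PiE_def extensional_def)
  then show ?thesis
    unfolding weighted_tuples_def mem_Collect_eq weighted_sum_increment[OF i] by auto
qed

text \<open>Tuples with v i = 0 contribute nothing; on the others, lowering v i by one is a
  bijection onto the tuples of weight m - i, and it trades the factor v i for s + r.\<close>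

lemma sum_component_weighted_tuples:
  assumes i: "i \<in> {1..k}" and r: "r \<ge> 1"
  shows "(\<Sum>v\<in>weighted_tuples k m. real (v i) * tuple_weight k r v) =
    tuple_sum1 k r (m - int i)"
proof -
  have "(\<Sum>v\<in>weighted_tuples k m. real (v i) * tuple_weight k r v) =
      (\<Sum>v\<in>{v \<in> weighted_tuples k m. v i \<noteq> 0}. real (v i) * tuple_weight k r v)"
    by (rule sum.mono_neutral_right) (auto simp: finite_weighted_tuples)
  also have "\<dots> = tuple_sum1 k r (m - int i)"
    unfolding tuple_sum1_def
  proof (rule sum.reindex_bij_witness[where i = "\<lambda>v. v(i := Suc (v i))"
        and j = "\<lambda>v. v(i := v i - 1)"], goal_cases)
    case (2 v)
    then show ?case
      using increment_in_weighted_tuples[OF i, of "v(i := v i - 1)" m] by (simp add: fun_upd_idem)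
  next
    case (4 v)
    then show ?case
      using increment_in_weighted_tuples[OF i, of v m] by simp
  next
    case (5 v)
    then show ?case
      using tuple_weight_increment[OF i r, of "v(i := v i - 1)"] by (simp add: fun_upd_idem)
  qed auto
  finally show ?thesis .
qed

text \<open>On the tuples involved m is the sum of i * v i, so the factor m splits over the
  components. This is the coefficient form of x G'.\<close>

lemma tuple_sum_derivative:
  assumes r: "r \<ge> 1"
  shows "of_int m * tuple_sum k r m = (\<Sum>i=1..k. real i * tuple_sum1 k r (m - int i))"
proof -
  have "of_int m * tuple_sum k r m =
      (\<Sum>v\<in>weighted_tuples k m. \<Sum>i=1..k. real i * (real (v i) * tuple_weight k r v))"
    unfolding tuple_sum_def sum_distrib_left
  proof (rule sum.cong)
    fix v assume "v \<in> weighted_tuples k m"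
    then have "of_int m = (\<Sum>i=1..k. real i * real (v i))"
      by (auto simp: weighted_tuples_def)
    then show "of_int m * tuple_weight k r v =
        (\<Sum>i=1..k. real i * (real (v i) * tuple_weight k r v))"
      by (simp add: sum_distrib_right mult.assoc)
  qed simp
  also have "\<dots> = (\<Sum>i=1..k. real i * (\<Sum>v\<in>weighted_tuples k m. real (v i) * tuple_weight k r v))"
    by (subst sum.swap) (simp add: sum_distrib_left)
  finally show ?thesis
    using sum_component_weighted_tuples[OF _ r] by simp
qed

text \<open>Splitting the factor s + r gives the coefficient form of (1 - x - ... - x^k) * (1 - x -
  ... - x^k)^(-(r+1)) = (1 - x - ... - x^k)^(-r), multiplied by r.\<close>

lemma tuple_sum1_step:
  assumes r: "r \<ge> 1"
  shows "tuple_sum1 k r m = real r * tuple_sum k r m + (\<Sum>i=1..k. tuple_sum1 k r (m - int i))"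
proof -
  have "tuple_sum1 k r m = real r * tuple_sum k r m +
      (\<Sum>v\<in>weighted_tuples k m. \<Sum>i=1..k. real (v i) * tuple_weight k r v)"
    by (simp add: tuple_sum1_def tuple_sum_def sum_distrib_left sum_distrib_right
        sum.distrib algebra_simps)
  also have "(\<Sum>v\<in>weighted_tuples k m. \<Sum>i=1..k. real (v i) * tuple_weight k r v) =
      (\<Sum>i=1..k. tuple_sum1 k r (m - int i))"
    by (subst sum.swap) (simp add: sum_component_weighted_tuples[OF _ r])
  finally show ?thesis .
qed

text \<open>The generating function $G = (1 - x - \cdots - x^k)^{-r}$ of the tuple sums satisfies
  $(1 - x - \cdots - x^k)\,G' = r\,(1 + 2x + \cdots + kx^{k-1})\,G$.\<close>

lemma tuple_sum_recurrence:
  assumes r: "r \<ge> 1"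
  shows "of_int m * tuple_sum k r m =
    (\<Sum>i=1..k. (of_int m + real i * (real r - 1)) * tuple_sum k r (m - int i))"
proof -
  have "(\<Sum>i=1..k. of_int (m - int i) * tuple_sum k r (m - int i)) =
      (\<Sum>i=1..k. \<Sum>l=1..k. real l * tuple_sum1 k r (m - int i - int l))"
    by (simp only: tuple_sum_derivative[OF r])
  also have "\<dots> = (\<Sum>l=1..k. real l * (\<Sum>i=1..k. tuple_sum1 k r (m - int l - int i)))"
    by (subst sum.swap) (simp add: sum_distrib_left algebra_simps)
  finally have "of_int m * tuple_sum k r m -
      (\<Sum>i=1..k. of_int (m - int i) * tuple_sum k r (m - int i)) =
      (\<Sum>l=1..k. real l * (tuple_sum1 k r (m - int l) - (\<Sum>i=1..k. tuple_sum1 k r (m - int l - int i))))"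
    by (simp add: tuple_sum_derivative[OF r] right_diff_distrib sum_subtractf)
  also have "\<dots> = (\<Sum>l=1..k. real l * (real r * tuple_sum k r (m - int l)))"
    by (intro sum.cong refl arg_cong2[where f = "(*)"])
       (subst tuple_sum1_step[OF r], simp)
  finally have "of_int m * tuple_sum k r m =
      (\<Sum>i=1..k. of_int (m - int i) * tuple_sum k r (m - int i)) +
      (\<Sum>i=1..k. real i * (real r * tuple_sum k r (m - int i)))"
    by linarith
  also have "\<dots> = (\<Sum>i=1..k. (of_int m + real i * (real r - 1)) * tuple_sum k r (m - int i))"
    by (simp add: sum.distrib[symmetric] algebra_simps)
  finally show ?thesis .
qed

section \<open>Rescaling for p = 1/2\<close>

definition scaled_pmf :: "nat \<Rightarrow> nat \<Rightarrow> int \<Rightarrow> real" where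
  "scaled_pmf k r m = (1/2) ^ nat m * tuple_sum k r m"

lemma nb_order_pmf_half:
  "nb_order_pmf k r (1/2) n = (1/2) ^ (k * r) * scaled_pmf k r (n - int (k * r))"
proof (cases "n < int (k * r)")
  case True
  then show ?thesis
    by (simp add: nb_order_pmf_def scaled_pmf_def tuple_sum_neg)
next
  case False
  then have "nat n = k * r + nat (n - int (k * r))"
    by linarith
  then show ?thesis
    using False
    by (simp add: nb_order_pmf_def scaled_pmf_def tuple_sum_def tuple_weight_def power_add)
qed

lemma scaled_pmf_recurrence:
  assumes r: "r \<ge> 1"
  shows "of_int m * scaled_pmf k r m =
    (\<Sum>j<k. (of_int m + real (Suc j) * (real r - 1)) * (1/2) ^ Suc j
      * scaled_pmf k r (m - 1 - int j))"
proof -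
  \<comment> \<open>Truncation by \<open>nat\<close> spoils the exponent law only when m - 1 - j <
    0, and there both sides vanish.\<close>
  have *: "(1/2::real) ^ nat m * tuple_sum k r (m - 1 - int j) =
      (1/2) ^ Suc j * scaled_pmf k r (m - 1 - int j)" for j
  proof (cases "m - 1 - int j < 0")
    case False
    then have "nat m = Suc j + nat (m - 1 - int j)"
      by linarith
    then show ?thesis
      by (simp add: scaled_pmf_def power_add)
  qed (simp add: scaled_pmf_def tuple_sum_neg)
  have "of_int m * scaled_pmf k r m = (1/2) ^ nat m * (of_int m * tuple_sum k r m)"
    by (simp add: scaled_pmf_def)
  also have "\<dots> = (\<Sum>j<k. (of_int m + real (Suc j) * (real r - 1)) *
      ((1/2) ^ nat m * tuple_sum k r (m - 1 - int j)))"
    unfolding tuple_sum_recurrence[OF r] sum_distrib_left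
    by (rule sum.reindex_bij_witness[where i = Suc and j = "\<lambda>i. i - 1"])
       (auto simp: algebra_simps of_nat_diff)
  finally show ?thesis
    unfolding * by (simp add: mult.assoc)
qed

section \<open>From the recurrence for b to one for its differences\<close>

lemma sum_by_parts:
  fixes W g :: "nat \<Rightarrow> real"
  shows "(\<Sum>j<n. W j * (g j - g (Suc j))) =
    W 0 * g 0 - W n * g n - (\<Sum>j<n. (W j - W (Suc j)) * g (Suc j))"
  by (induction n) (simp_all add: algebra_simps)

text \<open>The location of the maxima follows from these properties of b alone; tuples are no
  longer needed.\<close>

locale scaled_recurrence =
  fixes k r :: nat and b :: "int \<Rightarrow> real"
  assumes k2: "k \<ge> 2" and r2: "r \<ge> 2"
    and b_neg: "\<And>m. m < 0 \<Longrightarrow> b m = 0" and b_0: "b 0 = 1"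
    and recurrence: "\<And>m. of_int m * b m =
      (\<Sum>j<k. (of_int m + real (Suc j) * (real r - 1)) * (1/2) ^ Suc j * b (m - 1 - int j))"
begin

definition d :: "int \<Rightarrow> real" where
  "d m = b m - b (m - 1)"

text \<open>The weights of the recurrence at \<open>m = peak\<close> add up to exactly \<open>m\<close>; the maximum is attained
  one step earlier, at \<open>peak - 1\<close>.\<close>

definition peak :: int where
  "peak = (int r - 1) * (2 ^ (k + 1) - int k - 2)"

text \<open>For j <= k, a closed form of the tail sum, over indices from j to k - 1, of the weights
  in \<open>recurrence\<close>.\<close>

definition W :: "int \<Rightarrow> nat \<Rightarrow> real" where
  "W m j = of_int m * ((1/2) ^ j - (1/2) ^ k) +
     (real r - 1) * ((real j + 2) * (1/2) ^ j - (real k + 2) * (1/2) ^ k)"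

text \<open>Written so that the signs can be read off; \<open>C_eq\<close> shows how it arises from
  W.\<close>

definition C :: "int \<Rightarrow> nat \<Rightarrow> real" where
  "C m j = (of_int (peak - m) - 1) * (1/2) ^ j *
       (of_int m - 1 + (real r - 1) * (real j + 2) - real r) +
     2 * (2 * (real r - 1) - real r * (1/2) ^ j)"

lemma W_diff: "W m j - W m (Suc j) = (of_int m + real (Suc j) * (real r - 1)) * (1/2) ^ Suc j"
  by (simp add: W_def field_simps)

lemma W_k: "W m k = 0"
  by (simp add: W_def)

lemma two_power_k: "2 ^ k * (1/2) ^ k = (1::real)"
  by (simp add: power_mult_distrib[symmetric])

lemma of_int_peak: "of_int peak = (real r - 1) * (2 * 2 ^ k - real k - 2)"
  by (simp add: peak_def)

lemma W_0: "W m 0 = of_int m + (1/2) ^ k * of_int (peak - m)"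
proof -
  have "(1/2) ^ k * ((real r - 1) * (2 * 2 ^ k - real k - 2)) =
      (real r - 1) * (2 * (2 ^ k * (1/2) ^ k) - (real k + 2) * (1/2) ^ k)"
    by (simp add: algebra_simps)
  then show ?thesis
    unfolding W_def of_int_diff of_int_peak two_power_k by (simp add: algebra_simps)
qed

lemma sum_weights:
  "(\<Sum>j<k. (of_int m + real (Suc j) * (real r - 1)) * (1/2) ^ Suc j) =
    of_int m + (1/2) ^ k * of_int (peak - m)"
proof -
  have "(\<Sum>j<k. W m j - W m (Suc j)) = W m 0 - W m k"
    by (rule sum_lessThan_telescope')
  then show ?thesis
    by (simp only: W_diff W_k W_0)
qed

text \<open>Summation by parts turns tail sums of weights against differences into weights against
  values. The boundary term at k is 0, and \<open>recurrence\<close> evaluates the remaining sum as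
  m * b m.\<close>

lemma sum_W_d: "(\<Sum>j<k. W m j * d (m - int j)) = (1/2) ^ k * of_int (peak - m) * b m"
proof -
  have "(\<Sum>j<k. W m j * d (m - int j)) =
      (\<Sum>j<k. W m j * (b (m - int j) - b (m - int (Suc j))))"
    by (simp add: d_def algebra_simps)
  also have "\<dots> = W m 0 * b m - (\<Sum>j<k. (W m j - W m (Suc j)) * b (m - 1 - int j))"
    by (subst sum_by_parts) (simp add: W_k algebra_simps)
  also have "\<dots> = W m 0 * b m - of_int m * b m"
    unfolding W_diff recurrence ..
  also have "\<dots> = (1/2) ^ k * of_int (peak - m) * b m"
    unfolding W_0 by (simp add: algebra_simps)
  finally show ?thesis .
qed

lemma C_eq:
  "C m j = 2 * (of_int (peak - m) * W (m - 1) j - (of_int (peak - m) + 1) * W m (Suc j))"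
proof -
  \<comment> \<open>Here u = peak - m, x = m, h = (1/2)^(j+1), t = (1/2)^k and e = 2^k; what remains
    is polynomial algebra modulo e * t = 1.\<close>
  have alg: "(u - 1) * (2 * h) * (x - 1 + (R - 1) * (J + 2) - R) + 2 * (2 * (R - 1) - R * (2 * h)) =
      2 * (u * ((x - 1) * (2 * h - t) + (R - 1) * ((J + 2) * (2 * h) - (K + 2) * t)) -
        (u + 1) * (x * (h - t) + (R - 1) * ((J + 1 + 2) * h - (K + 2) * t)))"
    if "e * t = 1" "x = (R - 1) * (2 * e - K - 2) - u" for u h x R J K t e :: real
    using that by algebra
  have m: "of_int m = (real r - 1) * (2 * 2 ^ k - real k - 2) - of_int (peak - m)"
    by (simp add: of_int_peak)
  have "2 * (1/2 :: real) ^ Suc j = (1/2) ^ j"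
    "of_int (m - 1) = of_int m - (1::real)" "real (Suc j) = real j + 1"
    by simp_all
  note eqs = this
  show ?thesis
    using alg[OF two_power_k m, of "(1/2) ^ Suc j" "real j"]
    unfolding C_def W_def eqs .
qed

text \<open>With \<open>u = peak - m\<close>, this is \<open>u + 1\<close> times \<open>sum_W_d\<close> at \<open>m\<close> minus \<open>u\<close> times
  \<open>sum_W_d\<close> at \<open>m - 1\<close>.\<close>

lemma d_recurrence:
  "2 * (of_int (peak - m) + 1) * of_int m * d m = (\<Sum>j<k. C m j * d (m - 1 - int j))"
proof -
  define u where "u = (of_int (peak - m) :: real)"
  have "(\<Sum>j<k. W m j * d (m - int j)) = (\<Sum>j<Suc k. W m j * d (m - int j))"
    by (simp add: W_k)
  also have "\<dots> = W m 0 * d m + (\<Sum>j<k. W m (Suc j) * d (m - 1 - int j))"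
    by (subst sum.lessThan_Suc_shift) (simp add: algebra_simps)
  finally have 1: "W m 0 * d m + (\<Sum>j<k. W m (Suc j) * d (m - 1 - int j)) = (1/2) ^ k * u * b m"
    by (simp add: sum_W_d u_def)
  have 2: "(\<Sum>j<k. W (m - 1) j * d (m - 1 - int j)) = (1/2) ^ k * (u + 1) * b (m - 1)"
    by (subst sum_W_d) (simp add: u_def algebra_simps)
  have "(\<Sum>j<k. C m j * d (m - 1 - int j)) =
      2 * (u * (\<Sum>j<k. W (m - 1) j * d (m - 1 - int j)) -
           (u + 1) * (\<Sum>j<k. W m (Suc j) * d (m - 1 - int j)))"
    unfolding C_eq u_def[symmetric]
    by (simp add: sum_distrib_left sum_subtractf[symmetric] algebra_simps)
  also have "\<dots> = 2 * (u + 1) * of_int m * d m"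
  proof -
    \<comment> \<open>Both values of b acquire the same factor t * u * (u + 1), so they enter only
      through y - z = D; the coefficient w - t * u of D is x.\<close>
    have "2 * (u * S1 - (u + 1) * S2) = 2 * (u + 1) * x * D"
      if "w * D + S2 = t * u * y" "S1 = t * (u + 1) * z" "w = x + t * u" "D = y - z"
      for S1 S2 x D w t y z :: real
      using that by algebra
    from this[OF 1 2 W_0[of m, folded u_def] d_def] show ?thesis .
  qed
  finally show ?thesis
    by (simp add: u_def)
qed

section \<open>Monotonicity below the peak\<close>

text \<open>The last factor of the product equals (m - 1) + (r - 1) * j + (r - 2), and 2 * (r - 1)
  >= r bounds the second summand; both use r >= 2.\<close>

lemma C_nonneg:
  assumes "1 \<le> m" "m < peak"
  shows "C m j \<ge> 0"
proof -
  have r: "real r \<ge> 2" using r2 by simp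
  have "0 \<le> (real r - 1) * real j" using r by simp
  then have "0 \<le> of_int m - 1 + (real r - 1) * (real j + 2) - real r"
    using assms r by (simp add: algebra_simps)
  moreover have "0 \<le> of_int (peak - m) - (1::real)"
    using assms by linarith
  moreover have "real r * (1/2) ^ j \<le> real r"
    by (intro mult_left_le power_le_one) auto
  then have "real r * (1/2) ^ j \<le> 2 * (real r - 1)"
    by (rule order_trans) (use r in simp)
  then have "0 \<le> 2 * (2 * (real r - 1) - real r * (1/2) ^ j)"
    by simp
  ultimately show ?thesis
    unfolding C_def by simp
qed

text \<open>The second summand of C is 2 * (r - 2) at j = 0, which vanishes for r = 2, so the
  product must be strictly positive; hence the narrower range of m.\<close>

lemma C_0_pos:
  assumes "2 \<le> m" "m + 1 < peak"
  shows "C m 0 > 0"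
proof -
  have "0 < (of_int (peak - m) - 1) * (of_int m - 1 + (real r - 1) * 2 - real r)"
    using assms r2 by (intro mult_pos_pos) auto
  then show ?thesis
    using r2 by (simp add: C_def)
qed

lemma C_1_pos:
  assumes "1 \<le> m" "m < peak"
  shows "C m 1 > 0"
proof -
  have "0 \<le> (of_int (peak - m) - 1) * (1/2) * (of_int m - 1 + (real r - 1) * 3 - real r)"
    using assms r2 by (intro mult_nonneg_nonneg) auto
  then show ?thesis
    using r2 by (simp add: C_def)
qed

text \<open>Starting from d 0 = 1, each later d m is, up to a positive factor, a nonnegative
  combination of earlier differences.\<close>

lemma d_nonneg: "m < peak \<Longrightarrow> d m \<ge> 0"
proof (induction "nat m" arbitrary: m rule: less_induct)
  case less
  consider "m < 0" | "m = 0" | "m \<ge> 1" by linarith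
  then show ?case
  proof cases
    case 3
    have "0 \<le> (\<Sum>j<k. C m j * d (m - 1 - int j))"
      using 3 less by (intro sum_nonneg mult_nonneg_nonneg C_nonneg) auto
    then have "0 \<le> (2 * (of_int (peak - m) + 1) * of_int m) * d m"
      by (simp only: d_recurrence)
    moreover have "0 < 2 * (of_int (peak - m) + 1) * (of_int m :: real)"
      using 3 less.prems by simp
    ultimately show ?thesis
      by (simp only: zero_le_mult_iff) linarith
  qed (simp_all add: d_def b_neg b_0)
qed

lemma d_posI:
  assumes m: "1 \<le> m" "m < peak" and j: "j < k" "C m j > 0" "d (m - 1 - int j) > 0"
  shows "d m > 0"
proof -
  have "0 < (\<Sum>j<k. C m j * d (m - 1 - int j))"
    using m j by (intro sum_pos2[of _ j] mult_nonneg_nonneg C_nonneg d_nonneg) auto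
  then have "0 < (2 * (of_int (peak - m) + 1) * of_int m) * d m"
    by (simp only: d_recurrence)
  moreover have "0 < 2 * (of_int (peak - m) + 1) * (of_int m :: real)"
    using m by simp
  ultimately show ?thesis
    by (rule zero_less_mult_pos)
qed

text \<open>Positivity passes from d 0 = 1 in steps of two through C m 1. Since d 1 = 0 when r = 2,
  the case m = 3 instead uses d 2 and C 3 0, and this needs peak >= 5.\<close>

lemma d_pos:
  assumes "peak \<ge> 5"
  shows "2 \<le> m \<Longrightarrow> m < peak \<Longrightarrow> d m > 0"
proof (induction "nat m" arbitrary: m rule: less_induct)
  case less
  show ?case
  proof (cases "m = 3")
    case True
    have "d 2 > 0"
      using less True by auto
    then show ?thesis
      using True assms k2 C_0_pos[of 3] by (intro d_posI[of m 0]) auto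
  next
    case False
    have "d (m - 2) > 0"
    proof (cases "m = 2")
      case True
      then show ?thesis by (simp add: d_def b_neg b_0)
    next
      case False
      with \<open>m \<noteq> 3\<close> less show ?thesis by auto
    qed
    then show ?thesis
      using less.prems k2 C_1_pos[of m] by (intro d_posI[of m 1]) (auto simp: algebra_simps)
  qed
qed

lemma b_mono: "m \<le> n \<Longrightarrow> n < peak \<Longrightarrow> b m \<le> b n"
proof (induction n rule: int_ge_induct)
  case (step n)
  then show ?case
    using d_nonneg[of "n + 1"] by (simp add: d_def)
qed simp

text \<open>Separates the exceptional case from the range peak >= 5 in which \<open>d_pos\<close>
  applies.\<close>

lemma peak_ge: "peak \<ge> 4" and peak_eq_4_iff: "peak = 4 \<longleftrightarrow> (k, r) = (2, 2)"
proof -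
  have ge: "(2::int) ^ (k + 1) - int k - 2 \<ge> 4 \<and> (k \<ge> 3 \<longrightarrow> (2::int) ^ (k + 1) - int k - 2 \<ge> 5)"
    using k2 by (induction k rule: nat_induct_at_least) auto
  have r: "int r - 1 \<ge> 1" using r2 by simp
  have le: "1 * 4 \<le> peak"
    unfolding peak_def using ge r by (intro mult_mono) auto
  then show "peak \<ge> 4" by simp
  have "peak \<ge> 5" if "k \<ge> 3"
  proof -
    have "1 * 5 \<le> peak"
      unfolding peak_def using ge r that by (intro mult_mono) auto
    then show ?thesis by simp
  qed
  moreover have "peak \<ge> 5" if "r \<ge> 3"
  proof -
    have "2 * 4 \<le> peak"
      unfolding peak_def using ge that by (intro mult_mono) auto
    then show ?thesis by simp
  qed
  moreover have "peak = 4" if "(k, r) = (2, 2)"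
    unfolding peak_def using that by simp
  moreover have "k \<ge> 3 \<or> r \<ge> 3" if "(k, r) \<noteq> (2, 2)"
    using that k2 r2 by auto
  ultimately show "peak = 4 \<longleftrightarrow> (k, r) = (2, 2)"
    by fastforce
qed

section \<open>Bounds at and beyond the peak\<close>

lemma b_top_pos: "b (peak - 1) > 0"
  using b_mono[of 0 "peak - 1"] peak_ge b_0 by simp

lemma b_le_weighted_top:
  assumes "m \<ge> 0" "\<And>j. b (m - 1 - int j) \<le> b (peak - 1)"
  shows "of_int m * b m \<le> (of_int m + (1/2) ^ k * of_int (peak - m)) * b (peak - 1)"
proof -
  have "of_int m * b m \<le>
      (\<Sum>j<k. (of_int m + real (Suc j) * (real r - 1)) * (1/2) ^ Suc j * b (peak - 1))"
    unfolding recurrence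
    using assms r2 by (intro sum_mono mult_left_mono) auto
  then show ?thesis
    by (simp only: sum_distrib_right[symmetric] sum_weights)
qed

text \<open>From the peak on the total weight is at most m, so induction carries the bound upwards;
  below it monotonicity suffices.\<close>

lemma b_bound: "b m \<le> b (peak - 1)"
proof (induction "nat m" arbitrary: m rule: less_induct)
  case less
  show ?case
  proof (cases "m < peak")
    case True
    then show ?thesis by (intro b_mono) auto
  next
    case False
    then have m: "m > 0" using peak_ge by simp
    have "of_int m * b m \<le> (of_int m + (1/2) ^ k * of_int (peak - m)) * b (peak - 1)"
      using less m by (intro b_le_weighted_top) auto
    also have "\<dots> \<le> of_int m * b (peak - 1)"
      using False b_top_pos by (intro mult_right_mono) (auto simp: mult_nonneg_nonpos)
    finally show ?thesis
      using m by simp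
  qed
qed

lemma b_less_above:
  assumes "m > peak"
  shows "b m < b (peak - 1)"
proof -
  have m: "m > 0" using assms peak_ge by simp
  have "of_int m * b m \<le> (of_int m + (1/2) ^ k * of_int (peak - m)) * b (peak - 1)"
    using b_bound m by (intro b_le_weighted_top) auto
  also have "\<dots> < of_int m * b (peak - 1)"
    using assms b_top_pos by (intro mult_strict_right_mono) (auto simp: mult_pos_neg)
  finally show ?thesis
    using m by simp
qed

text \<open>At m = peak the weights add up to exactly m, so strictness has to come from a single
  term: j = 1, where b (peak - 2) has positive weight.\<close>

lemma b_peak_less:
  assumes "b (peak - 2) < b (peak - 1)"
  shows "b peak < b (peak - 1)"
proof -
  have "of_int peak * b peak <
      (\<Sum>j<k. (of_int peak + real (Suc j) * (real r - 1)) * (1/2) ^ Suc j * b (peak - 1))"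
    unfolding recurrence
  proof (rule sum_strict_mono_ex1)
    show "\<forall>j\<in>{..<k}. (of_int peak + real (Suc j) * (real r - 1)) * (1/2) ^ Suc j * b (peak - 1 - int j)
        \<le> (of_int peak + real (Suc j) * (real r - 1)) * (1/2) ^ Suc j * b (peak - 1)"
      using b_bound peak_ge r2 by (intro ballI mult_left_mono) auto
    have "0 < (of_int peak + real (Suc 1) * (real r - 1)) * (1/2) ^ Suc 1"
      using peak_ge r2 by (intro mult_pos_pos add_pos_nonneg) auto
    then show "\<exists>j\<in>{..<k}. (of_int peak + real (Suc j) * (real r - 1)) * (1/2) ^ Suc j * b (peak - 1 - int j)
        < (of_int peak + real (Suc j) * (real r - 1)) * (1/2) ^ Suc j * b (peak - 1)"
      using assms k2 by (intro bexI[of _ 1] mult_strict_left_mono) auto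
  qed simp
  also have "\<dots> = of_int peak * b (peak - 1)"
    by (simp only: sum_distrib_right[symmetric] sum_weights) simp
  finally show ?thesis
    using peak_ge by simp
qed

section \<open>The set of maximisers\<close>

lemma maximal_iff_top: "(\<forall>n. b n \<le> b m) \<longleftrightarrow> b m = b (peak - 1)"
  using b_bound by (metis order_antisym order_refl)

lemma maximal_iff_generic:
  assumes "(k, r) \<noteq> (2, 2)"
  shows "(\<forall>n. b n \<le> b m) \<longleftrightarrow> m = peak - 1"
proof -
  have "peak \<ge> 5"
    using peak_ge peak_eq_4_iff assms by linarith
  then have less: "b (peak - 2) < b (peak - 1)"
    using d_pos[of "peak - 1"] by (simp add: d_def)
  have "b m < b (peak - 1)" if ne: "m \<noteq> peak - 1"
  proof -
    consider "m \<le> peak - 2" | "m = peak" | "m > peak"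
      using ne by linarith
    then show ?thesis
    proof cases
      case 1
      then show ?thesis using b_mono[of m "peak - 2"] less by simp
    qed (use b_peak_less[OF less] b_less_above in auto)
  qed
  then show ?thesis
    unfolding maximal_iff_top by fastforce
qed

lemma maximal_iff_exceptional:
  assumes "(k, r) = (2, 2)"
  shows "(\<forall>n. b n \<le> b m) \<longleftrightarrow> m \<in> {2, 3, 4}"
proof -
  have kr: "k = 2" "r = 2" using assms by auto
  have peak: "peak = 4" using assms peak_eq_4_iff by simp
  \<comment> \<open>This reads m * b m = (m + 1)/2 * b (m - 1) + (m + 2)/4 * b (m - 2);
    \<open>numeral_2_eq_2\<close> lets the range of summation unfold.\<close>
  note rec = recurrence[unfolded kr, simplified numeral_2_eq_2 lessThan_Suc, simplified]
  have b1: "b 1 = 1" using rec[of 1] b_0 b_neg[of "-1"] by simp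
  have b2: "b 2 = 5/4" using rec[of 2] b_0 b1 by simp
  have b3: "b 3 = 5/4" using rec[of 3] b1 b2 by simp
  have b4: "b 4 = 5/4" using rec[of 4] b2 b3 by simp
  have "b m < 5/4" if "m \<notin> {2, 3, 4}"
  proof -
    consider "m \<le> 1" | "m > 4" using \<open>m \<notin> {2, 3, 4}\<close> by force
    then show ?thesis
      using b_mono[of m 1] b_less_above[of m] b1 b3 by cases (auto simp: peak)
  qed
  then show ?thesis
    unfolding maximal_iff_top peak using b2 b3 b4 by force
qed

end

section \<open>Transfer to the distribution\<close>

lemma scaled_recurrence_scaled_pmf:
  assumes "k \<ge> 2" "r \<ge> 2"
  shows "scaled_recurrence k r (scaled_pmf k r)"
proof
  show "scaled_pmf k r m = 0" if "m < 0" for m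
    using that by (simp add: scaled_pmf_def tuple_sum_neg)
  show "scaled_pmf k r 0 = 1"
    by (simp add: scaled_pmf_def tuple_sum_zero)
qed (use assms scaled_pmf_recurrence[of r] in auto)

theorem theorem2p3:
  fixes k r :: nat
  assumes "k \<ge> 2" and "r \<ge> 2"
  shows "nb_order_modes k r (1/2) =
    {int k * int r + (int r - 1) * (2 ^ (k + 1) - int k - 2) - 1 + \<delta> | \<delta>. \<delta> \<in> mode_shifts k r}"
proof -
  interpret scaled_recurrence k r "scaled_pmf k r"
    using assms by (rule scaled_recurrence_scaled_pmf)
  have modes: "n \<in> nb_order_modes k r (1/2) \<longleftrightarrow>
      (\<forall>m. scaled_pmf k r m \<le> scaled_pmf k r (n - int (k * r)))" for n
  proof -
    have "n \<in> nb_order_modes k r (1/2) \<longleftrightarrow>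
        (\<forall>n'. scaled_pmf k r (n' - int (k * r)) \<le> scaled_pmf k r (n - int (k * r)))"
      by (simp add: nb_order_modes_def nb_order_pmf_half)
    then show ?thesis
      \<comment> \<open>Every integer m has the form n' - k * r, with n' = m + k * r.\<close>
      by (metis add_diff_cancel_right')
  qed
  show ?thesis
  proof (cases "(k, r) = (2, 2)")
    case True
    \<comment> \<open>Here peak - 1 = 3, so the maximisers 2, 3, 4 are the shifts of it by -1, 0 and
      1.\<close>
    then show ?thesis
      unfolding set_eq_iff modes maximal_iff_exceptional[OF True] Setcompr_eq_image
      by (auto simp: mode_shifts_def)
  next
    case False
    then show ?thesis
      unfolding set_eq_iff modes maximal_iff_generic[OF False]
      by (auto simp: mode_shifts_def peak_def)
  qed
qed

end
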